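(* Let $X$ be an $\mathbb{N}$-valued random variable with $X\in TN_2$. Then for all partitions $\lambda$ and $\mu$, $\lambda\trianglerighteq\mu$ implies $C(\lambda,\mu,X)$.
   Context: $\mathbb{N}$ denotes the set of non-negative integers. A partition is a non-increasing function $\lambda:\mathbb{N}\setminus\{0\}\to\mathbb{N}$ with finite support; its weight is $|\lambda|=\sum_i \lambda(i)$. Dominance: $\lambda \trianglerighteq \mu$ iff $|\lambda|=|\mu|$ and $\sum_{i=1}^j \lambda(i) \ge \sum_{i=1}^j \mu(i)$ for all positive integers $j$. For a real sequence $p=\{p_n\}_{n\ge 0}$ let $\mathcal{T}_p$ be the $\mathbb{N}\times\mathbb{N}$ matrix with $(\mathcal{T}_p)_{i,j}=p_{j-i}$, where $p_n=0$ for $n<0$. A matrix is $TN_k$ if all its minors of order at most $k$ are non-negative. $X\in TN_2$ means $\mathcal{T}_{p}\in TN_2$ for $p=\{P(X=n)\}_{n\ge0}$. For a partition $\nu$, let $Y_1,Y_2,\ldots$ be independent random variables, where $Y_i$ is distributed as the sum of $\nu(i)$ independent copies of $X$ (and $Y_i\equiv 0$ if $\nu(i)=0$). For $j,t\in\mathbb{N}$, $E(\nu,X,j,t)$ is the event that $Y_i\le t$ for all $i\ge1$ and $\sum_{i\ge1} Y_i=j$. For partitions $\lambda,\mu$, $C(\lambda,\mu,X)$ is the condition that $P(E(\lambda,X,j,t))\le P(E(\mu,X,j,t))$ for all $j,t\in\mathbb{N}$. *)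

theory Defs
  imports "HOL-Probability.Probability" "Jordan_Normal_Form.Determinant"
begin

text \<open>
  Partitions are functions on the positive integers; the value at \<open>0\<close> is never inspected.
\<close>

definition is_partition :: "(nat \<Rightarrow> nat) \<Rightarrow> bool" where
  "is_partition \<nu> \<longleftrightarrow>
     (\<forall>i j. 1 \<le> i \<and> i \<le> j \<longrightarrow> \<nu> j \<le> \<nu> i) \<and> finite {i. 1 \<le> i \<and> \<nu> i \<noteq> 0}"

definition weight :: "(nat \<Rightarrow> nat) \<Rightarrow> nat" where
  "weight \<nu> = (\<Sum>i | 1 \<le> i \<and> \<nu> i \<noteq> 0. \<nu> i)"

definition dominates :: "(nat \<Rightarrow> nat) \<Rightarrow> (nat \<Rightarrow> nat) \<Rightarrow> bool" (infix \<open>\<unrhd>\<close> 50) where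
  "\<kappa> \<unrhd> \<mu> \<longleftrightarrow>
     weight \<kappa> = weight \<mu> \<and> (\<forall>j\<ge>1. (\<Sum>i=1..j. \<kappa> i) \<ge> (\<Sum>i=1..j. \<mu> i))"

definition toeplitz :: "(nat \<Rightarrow> real) \<Rightarrow> nat \<Rightarrow> nat \<Rightarrow> real" where
  "toeplitz p i j = (if i \<le> j then p (j - i) else 0)"

text \<open>
  A minor of order \<open>m\<close> of an infinite matrix is selected by strictly increasing row indices \<open>r\<close>
  and column indices \<open>c\<close>. The determinant is qualified because the analysis library has one too.
\<close>

definition totally_nonneg :: "nat \<Rightarrow> (nat \<Rightarrow> nat \<Rightarrow> real) \<Rightarrow> bool" where
  "totally_nonneg k A \<longleftrightarrow>
     (\<forall>m r c. 1 \<le> m \<and> m \<le> k \<and> strict_mono_on {..<m} r \<and> strict_mono_on {..<m} c \<longrightarrow>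
        Determinant.det (Matrix.mat m m (\<lambda>(a, b). A (r a) (c b))) \<ge> 0)"

definition TN_var :: "nat \<Rightarrow> 'a measure \<Rightarrow> ('a \<Rightarrow> nat) \<Rightarrow> bool" where
  "TN_var k M X \<longleftrightarrow>
     totally_nonneg k (toeplitz (\<lambda>n. Sigma_Algebra.measure M {\<omega> \<in> space M. X \<omega> = n}))"

text \<open>
  The coordinates \<open>\<omega> (i, l)\<close> of the product space are independent copies of \<open>X\<close>, so the variables
  \<open>row_sum \<nu> i\<close>, built from disjoint blocks of coordinates, are independent, each distributed as the
  sum of \<open>\<nu> i\<close> independent copies of \<open>X\<close>, and identically zero when \<open>\<nu> i = 0\<close>.
\<close>

definition copies :: "'a measure \<Rightarrow> ('a \<Rightarrow> nat) \<Rightarrow> (nat \<times> nat \<Rightarrow> nat) measure" where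
  "copies M X = (\<Pi>\<^sub>M _ \<in> UNIV. distr M (count_space UNIV) X)"

definition row_sum :: "(nat \<Rightarrow> nat) \<Rightarrow> nat \<Rightarrow> (nat \<times> nat \<Rightarrow> nat) \<Rightarrow> nat" where
  "row_sum \<nu> i \<omega> = (\<Sum>l<\<nu> i. \<omega> (i, l))"

definition event_E ::
  "(nat \<Rightarrow> nat) \<Rightarrow> 'a measure \<Rightarrow> ('a \<Rightarrow> nat) \<Rightarrow> nat \<Rightarrow> nat \<Rightarrow> (nat \<times> nat \<Rightarrow> nat) set" where
  "event_E \<nu> M X j t = {\<omega> \<in> space (copies M X).
     (\<forall>i\<ge>1. row_sum \<nu> i \<omega> \<le> t) \<and> (\<Sum>i | 1 \<le> i \<and> \<nu> i \<noteq> 0. row_sum \<nu> i \<omega>) = j}"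

definition cond_C ::
  "(nat \<Rightarrow> nat) \<Rightarrow> (nat \<Rightarrow> nat) \<Rightarrow> 'a measure \<Rightarrow> ('a \<Rightarrow> nat) \<Rightarrow> bool" where
  "cond_C \<kappa> \<mu> M X \<longleftrightarrow>
     (\<forall>j t. Sigma_Algebra.measure (copies M X) (event_E \<kappa> M X j t)
          \<le> Sigma_Algebra.measure (copies M X) (event_E \<mu> M X j t))"

end

theory Submission
  imports Defs
begin

text \<open>
  With \<open>P\<close> the generating function of \<open>X\<close>, the probability of \<open>E(\<nu>, X, j, t)\<close> is the
  coefficient of \<open>x\<^sup>j\<close> in the product over \<open>i\<close> of the truncations of \<open>P ^ \<nu> i\<close> to degree at most
  \<open>t\<close>. Log-concavity passes from \<open>P\<close> to its powers, and makes the ratio of the coefficients of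
  \<open>P ^ a\<close> to those of \<open>P ^ b\<close> nondecreasing for \<open>b \<le> a\<close>. Hence moving one copy of \<open>X\<close> from a longer
  row to a shorter one decreases no coefficient, and dominance is a chain of such moves.
\<close>

section \<open>Total positivity of order two and log-concave power series\<close>

text \<open>Averaging the double sum with its transpose replaces \<open>H k l\<close> by half of
  \<open>H k l - H l k\<close>, which agrees in sign with \<open>G k l\<close>. In
  \<open>TP2_product\<close>, \<open>G\<close> is a minor of one factor and \<open>H\<close> a
  product of entries of the other.\<close>

lemma antisymmetric_sum_nonneg:
  fixes G H :: "'i::linorder \<Rightarrow> 'i \<Rightarrow> real"
  assumes anti: "\<And>k l. G l k = - G k l"
    and G: "\<And>k l. k \<le> l \<Longrightarrow> 0 \<le> G k l"
    and H: "\<And>k l. k \<le> l \<Longrightarrow> H l k \<le> H k l"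
  shows "0 \<le> (\<Sum>k\<in>K. \<Sum>l\<in>K. H k l * G k l)"
proof -
  have "(\<Sum>k\<in>K. \<Sum>l\<in>K. H k l * G k l) = (\<Sum>k\<in>K. \<Sum>l\<in>K. H l k * G l k)"
    by (rule sum.swap)
  also have "\<dots> = - (\<Sum>k\<in>K. \<Sum>l\<in>K. H l k * G k l)"
    unfolding sum_negf[symmetric] by (intro sum.cong refl) (metis anti mult_minus_right)
  finally have "2 * (\<Sum>k\<in>K. \<Sum>l\<in>K. H k l * G k l) = (\<Sum>k\<in>K. \<Sum>l\<in>K. (H k l - H l k) * G k l)"
    by (simp add: left_diff_distrib sum_subtractf)
  moreover have "0 \<le> (H k l - H l k) * G k l" for k l
  proof (cases "k \<le> l")
    case True
    then show ?thesis using G H by simp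
  next
    case False
    then have "0 \<le> G l k" "H k l \<le> H l k" using G H by auto
    then show ?thesis using anti[of l k] by (simp add: mult_nonpos_nonpos)
  qed
  ultimately show ?thesis
    by (smt (verit) sum_nonneg)
qed

text \<open>Weakly ordered indices are harmless: a minor with a repeated row or column is
  zero.\<close>

definition TP2 :: "(nat \<Rightarrow> nat \<Rightarrow> real) \<Rightarrow> bool" where
  "TP2 A \<longleftrightarrow> (\<forall>i i' j j'. i \<le> i' \<longrightarrow> j \<le> j' \<longrightarrow> A i j' * A i' j \<le> A i j * A i' j')"

lemma TP2D: "TP2 A \<Longrightarrow> i \<le> i' \<Longrightarrow> j \<le> j' \<Longrightarrow> A i j' * A i' j \<le> A i j * A i' j'"
  by (auto simp: TP2_def)

text \<open>The two by two case of the Cauchy--Binet formula.\<close>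

lemma TP2_product:
  assumes A: "TP2 A" and B: "TP2 B"
    and C: "\<And>i j N. j \<le> N \<Longrightarrow> C i j = (\<Sum>k\<le>N. A i k * B k j)"
  shows "TP2 C"
  unfolding TP2_def
proof (intro allI impI)
  fix i i' j j' :: nat
  assume ij: "i \<le> i'" "j \<le> j'"
  let ?G = "\<lambda>k l. B k j * B l j' - B k j' * B l j"
  have "0 \<le> (\<Sum>k\<le>j'. \<Sum>l\<le>j'. (A i k * A i' l) * ?G k l)"
  proof (rule antisymmetric_sum_nonneg)
    fix k l :: nat
    assume "k \<le> l"
    then show "0 \<le> ?G k l"
      using TP2D[OF B \<open>k \<le> l\<close> ij(2)] by simp
    show "A i l * A i' k \<le> A i k * A i' l"
      by (rule TP2D[OF A ij(1) \<open>k \<le> l\<close>])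
  qed simp
  also have "\<dots> = C i j * C i' j' - C i j' * C i' j"
    unfolding C[OF ij(2)] C[OF order_refl[of j']] sum_product sum_subtractf[symmetric]
    by (intro sum.cong refl) (simp add: algebra_simps)
  finally show "C i j' * C i' j \<le> C i j * C i' j'" by simp
qed

text \<open>The Toeplitz form also excludes internal zeros, which the inequality for three
  consecutive coefficients would allow; series with internal zeros can have products that are not
  log-concave.\<close>

definition log_concave_fps :: "real fps \<Rightarrow> bool" where
  "log_concave_fps f \<longleftrightarrow> (\<forall>n. 0 \<le> fps_nth f n) \<and> TP2 (toeplitz (fps_nth f))"

lemma fps_mult_nth_nonneg:
  fixes f g :: "real fps"
  assumes "\<And>n. 0 \<le> fps_nth f n" "\<And>n. 0 \<le> fps_nth g n"
  shows "0 \<le> fps_nth (f * g) n"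
  by (simp add: fps_mult_nth assms sum_nonneg)

lemma fps_mult_nth_right_mono:
  fixes f g h :: "real fps"
  assumes "\<And>n. fps_nth f n \<le> fps_nth g n" "\<And>n. 0 \<le> fps_nth h n"
  shows "fps_nth (f * h) n \<le> fps_nth (g * h) n"
  unfolding fps_mult_nth by (intro sum_mono mult_right_mono assms)

lemma fps_prod_nth_nonneg:
  fixes f :: "'i \<Rightarrow> real fps"
  assumes "\<And>i n. i \<in> I \<Longrightarrow> 0 \<le> fps_nth (f i) n"
  shows "0 \<le> fps_nth (\<Prod>i\<in>I. f i) n"
  using assms
  by (induction I arbitrary: n rule: infinite_finite_induct) (auto intro!: fps_mult_nth_nonneg)

text \<open>Toeplitz matrices multiply as their series do, and being upper triangular they give
  finite sums. The free bound \<open>N\<close> lets two columns be expanded over one range.\<close>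

lemma toeplitz_fps_mult:
  assumes "j \<le> N"
  shows "toeplitz (fps_nth (f * g)) i j =
    (\<Sum>k\<le>N. toeplitz (fps_nth f) i k * toeplitz (fps_nth g) k j)"
proof (cases "i \<le> j")
  case True
  have "(\<Sum>k\<le>N. toeplitz (fps_nth f) i k * toeplitz (fps_nth g) k j) =
      (\<Sum>k\<in>{i..j}. fps_nth f (k - i) * fps_nth g (j - k))"
    by (rule sum.mono_neutral_cong_right) (use assms in \<open>auto simp: toeplitz_def\<close>)
  also have "\<dots> = (\<Sum>x=0..j - i. fps_nth f x * fps_nth g (j - i - x))"
    by (rule sum.reindex_bij_witness[of _ "\<lambda>x. x + i" "\<lambda>k. k - i"]) (use True in auto)
  finally show ?thesis using True by (simp add: toeplitz_def fps_mult_nth)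
next
  case False
  then show ?thesis by (auto simp: toeplitz_def intro!: sum.neutral)
qed

lemma log_concave_fps_mult:
  assumes "log_concave_fps f" "log_concave_fps g"
  shows "log_concave_fps (f * g)"
  unfolding log_concave_fps_def
proof
  show "\<forall>n. 0 \<le> fps_nth (f * g) n"
    using assms fps_mult_nth_nonneg by (auto simp: log_concave_fps_def)
  show "TP2 (toeplitz (fps_nth (f * g)))"
    by (rule TP2_product[where A = "toeplitz (fps_nth f)" and B = "toeplitz (fps_nth g)"])
      (use assms in \<open>auto simp: log_concave_fps_def toeplitz_fps_mult\<close>)
qed

lemma log_concave_fps_1: "log_concave_fps 1"
  by (auto simp: log_concave_fps_def TP2_def toeplitz_def)

lemma log_concave_fps_power: "log_concave_fps f \<Longrightarrow> log_concave_fps (f ^ k)"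
  by (induction k) (auto intro: log_concave_fps_mult log_concave_fps_1)

text \<open>The monotone ratio of \<open>g * f\<close> to \<open>f\<close> is cross-multiplied
  because coefficients of \<open>f\<close> may vanish. It sums, with the weights
  \<open>fps_nth g x\<close>, the minors of rows \<open>0\<close>, \<open>x\<close> and columns
  \<open>m\<close>, \<open>n\<close>.\<close>

lemma log_concave_fps_mult_ratio_mono:
  assumes g: "\<And>n. 0 \<le> fps_nth g n" and f: "log_concave_fps f" and "m \<le> n"
  shows "fps_nth (g * f) m * fps_nth f n \<le> fps_nth (g * f) n * fps_nth f m"
proof -
  let ?T = "toeplitz (fps_nth f)"
  have expand: "fps_nth (g * f) k = (\<Sum>x\<le>n. fps_nth g x * ?T x k)" if "k \<le> n" for k
    using toeplitz_fps_mult[OF that, of g f 0] by (simp add: toeplitz_def)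
  have "?T 0 n * ?T x m \<le> ?T 0 m * ?T x n" for x
    using f \<open>m \<le> n\<close> by (intro TP2D) (auto simp: log_concave_fps_def)
  then have "fps_nth g x * ?T x m * fps_nth f n \<le> fps_nth g x * ?T x n * fps_nth f m" for x
    unfolding mult.assoc by (intro mult_left_mono g) (simp add: toeplitz_def mult.commute)
  then show ?thesis
    unfolding expand[OF \<open>m \<le> n\<close>] expand[OF order_refl] sum_distrib_right
    by (rule sum_mono)
qed

section \<open>Moving one factor between two truncated series\<close>

text \<open>Reflecting \<open>u\<close> to \<open>s - u\<close> and averaging turns
  \<open>c u\<close> into half of \<open>c u - c (s - u)\<close>, which agrees in sign with
  \<open>D u\<close> on both halves.\<close>

lemma reflected_sum_nonneg:
  fixes c D :: "nat \<Rightarrow> real"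
  assumes anti: "\<And>u. u \<le> s \<Longrightarrow> D (s - u) = - D u"
    and D: "\<And>u. 2 * u \<le> s \<Longrightarrow> 0 \<le> D u"
    and c: "\<And>u. 2 * u \<le> s \<Longrightarrow> c (s - u) \<le> c u"
  shows "0 \<le> (\<Sum>u=0..s. c u * D u)"
proof -
  have "(\<Sum>u=0..s. c u * D u) = (\<Sum>u=0..s. c (s - u) * D (s - u))"
    by (rule sum.reindex_bij_witness[of _ "\<lambda>u. s - u" "\<lambda>u. s - u"]) auto
  also have "\<dots> = - (\<Sum>u=0..s. c (s - u) * D u)"
    unfolding sum_negf[symmetric] by (intro sum.cong refl) (simp add: anti)
  finally have "2 * (\<Sum>u=0..s. c u * D u) = (\<Sum>u=0..s. (c u - c (s - u)) * D u)"
    by (simp add: left_diff_distrib sum_subtractf)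
  moreover have "0 \<le> (c u - c (s - u)) * D u" if "u \<le> s" for u
  proof (cases "2 * u \<le> s")
    case True
    then show ?thesis using c D by simp
  next
    case False
    then have "0 \<le> D (s - u)" "c u \<le> c (s - u)" using D[of "s - u"] c[of "s - u"] that by auto
    then show ?thesis using anti[OF that] by (simp add: mult_nonpos_nonpos)
  qed
  then have "0 \<le> (\<Sum>u=0..s. (c u - c (s - u)) * D u)"
    by (intro sum_nonneg) simp
  ultimately show ?thesis by simp
qed

text \<open>Isolates \<open>P\<close>, the copy to be moved: it supplies degree \<open>x\<close>,
  \<open>f\<close> supplies \<open>u\<close> and \<open>g\<close> the rest. The indicator records
  both cutoffs.\<close>

lemma cutoff_mult_nth:
  fixes P f g :: "real fps"
  shows "fps_nth (fps_cutoff N (P * f) * fps_cutoff N g) j =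
    (\<Sum>x=0..j. fps_nth P x * (\<Sum>u=0..j - x.
      of_bool (x + u < N \<and> j - x - u < N) * (fps_nth f u * fps_nth g (j - x - u))))"
proof -
  let ?h = "\<lambda>x u m. of_bool (x + u < N \<and> m < N) * (fps_nth P x * fps_nth f u * fps_nth g m)"
  have "fps_nth (fps_cutoff N (P * f) * fps_cutoff N g) j =
      (\<Sum>n=0..j. \<Sum>x=0..n. ?h x (n - x) (j - n))"
    by (auto simp: fps_mult_nth sum_distrib_right intro!: sum.cong)
  also have "\<dots> = (\<Sum>x=0..j. \<Sum>u=0..j - x. ?h x u (j - x - u))"
    by (rule fps_mult_assoc_lemma)
  finally show ?thesis
    by (simp add: sum_distrib_left mult.assoc mult.left_commute)
qed

text \<open>
  Conditioning on the value \<open>x\<close> of the copy that is moved, the two sides differ only in which of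
  the two remaining sums receives \<open>x\<close>; swapping these sums pairs the terms so that the ratio
  hypothesis applies.
\<close>

lemma cutoff_mult_transfer:
  fixes P f g :: "real fps"
  assumes P: "\<And>n. 0 \<le> fps_nth P n"
    and ratio: "\<And>m n. m \<le> n \<Longrightarrow> fps_nth f m * fps_nth g n \<le> fps_nth f n * fps_nth g m"
  shows "fps_nth (fps_cutoff N (P * f) * fps_cutoff N g) j
    \<le> fps_nth (fps_cutoff N f * fps_cutoff N (P * g)) j"
proof -
  have "(\<Sum>u=0..s. of_bool (x + u < N \<and> s - u < N) * (fps_nth f u * fps_nth g (s - u)))
      \<le> (\<Sum>u=0..s. of_bool (x + u < N \<and> s - u < N) * (fps_nth g u * fps_nth f (s - u)))"
    (is "(\<Sum>u=0..s. ?c u * _) \<le> _") for x s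
  proof -
    have "0 \<le> (\<Sum>u=0..s. ?c u * (fps_nth g u * fps_nth f (s - u) - fps_nth f u * fps_nth g (s - u)))"
    proof (rule reflected_sum_nonneg)
      fix u
      assume u: "2 * u \<le> s"
      then show "0 \<le> fps_nth g u * fps_nth f (s - u) - fps_nth f u * fps_nth g (s - u)"
        using ratio[of u "s - u"] by (simp add: mult.commute)
      \<comment> \<open>Since \<open>u \<le> s - u\<close>, the bound \<open>x + (s - u) < N\<close>
        implies both \<open>x + u < N\<close> and \<open>s - u < N\<close>.\<close>
      show "?c (s - u) \<le> (?c u :: real)"
        using u by auto
    qed (simp add: algebra_simps)
    then show ?thesis by (simp add: right_diff_distrib sum_subtractf)
  qed
  from mult_left_mono[OF this P] show ?thesis
    unfolding mult.commute[of "fps_cutoff N f"] cutoff_mult_nth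
    by (rule sum_mono)
qed

lemma cutoff_power_transfer:
  fixes P :: "real fps"
  assumes P: "log_concave_fps P" and "b \<le> a"
  shows "fps_nth (fps_cutoff N (P ^ Suc a) * fps_cutoff N (P ^ b)) j
    \<le> fps_nth (fps_cutoff N (P ^ a) * fps_cutoff N (P ^ Suc b)) j"
  unfolding power_Suc
proof (rule cutoff_mult_transfer)
  have nonneg: "0 \<le> fps_nth (P ^ k) n" for k n
    using log_concave_fps_power[OF P] by (auto simp: log_concave_fps_def)
  show "0 \<le> fps_nth P n" for n
    using nonneg[of 1] by simp
  show "fps_nth (P ^ a) m * fps_nth (P ^ b) n \<le> fps_nth (P ^ a) n * fps_nth (P ^ b) m" if "m \<le> n" for m n
    using log_concave_fps_mult_ratio_mono[OF nonneg log_concave_fps_power[OF P] that, of "a - b" b]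
      \<open>b \<le> a\<close> by (simp flip: power_add)
qed

section \<open>Dominance as a chain of moves between rows\<close>

text \<open>For \<open>N = Suc t\<close> and \<open>P = pgf M X\<close> this generates the total of
  rows \<open>1\<close> to \<open>n\<close> on the event that none exceeds \<open>t\<close>.\<close>

definition cutoff_product :: "nat \<Rightarrow> real fps \<Rightarrow> nat \<Rightarrow> (nat \<Rightarrow> nat) \<Rightarrow> real fps" where
  "cutoff_product N P n \<nu> = (\<Prod>i=1..n. fps_cutoff N (P ^ \<nu> i))"

text \<open>The untouched rows form a series with nonnegative coefficients, so the inequality for
  rows \<open>i\<close> and \<open>k\<close> survives multiplication by it.\<close>

lemma cutoff_product_transfer:
  assumes P: "log_concave_fps P"
    and i: "i \<in> {1..n}" and k: "k \<in> {1..n}" and "i \<noteq> k" and "\<nu> k < \<nu> i"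
  shows "fps_nth (cutoff_product N P n \<nu>) j
    \<le> fps_nth (cutoff_product N P n (\<nu>(i := \<nu> i - 1, k := Suc (\<nu> k)))) j"
proof -
  let ?\<nu>' = "\<nu>(i := \<nu> i - 1, k := Suc (\<nu> k))"
  let ?R = "\<Prod>l\<in>{1..n} - {i} - {k}. fps_cutoff N (P ^ \<nu> l)"
  have split: "cutoff_product N P n \<eta> = (fps_cutoff N (P ^ \<eta> i) * fps_cutoff N (P ^ \<eta> k)) *
      (\<Prod>l\<in>{1..n} - {i} - {k}. fps_cutoff N (P ^ \<eta> l))" for \<eta>
    unfolding cutoff_product_def mult.assoc
    by (subst prod.remove[of _ i], simp, rule i, subst prod.remove[of _ k], simp)
      (use k \<open>i \<noteq> k\<close> in auto)
  have R: "0 \<le> fps_nth ?R m" for m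
    by (rule fps_prod_nth_nonneg)
      (use log_concave_fps_power[OF P] in \<open>auto simp: log_concave_fps_def\<close>)
  have "(\<Prod>l\<in>{1..n} - {i} - {k}. fps_cutoff N (P ^ ?\<nu>' l)) = ?R"
    by (rule prod.cong) auto
  then have split': "cutoff_product N P n ?\<nu>' =
      (fps_cutoff N (P ^ ?\<nu>' i) * fps_cutoff N (P ^ ?\<nu>' k)) * ?R"
    using split[of ?\<nu>'] by (simp only:)
  have "fps_nth (fps_cutoff N (P ^ \<nu> i) * fps_cutoff N (P ^ \<nu> k)) m
      \<le> fps_nth (fps_cutoff N (P ^ ?\<nu>' i) * fps_cutoff N (P ^ ?\<nu>' k)) m" for m
    using cutoff_power_transfer[OF P, of "\<nu> k" "\<nu> i - 1" N m] \<open>\<nu> k < \<nu> i\<close> \<open>i \<noteq> k\<close>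
    by (simp del: power_Suc)
  then show ?thesis
    unfolding split[of \<nu>] split' by (rule fps_mult_nth_right_mono) (rule R)
qed

text \<open>
  Each step moves one unit from a row \<open>i\<close> that is too long to the first row \<open>k\<close> that is too short.
  Only the target \<open>\<mu>\<close> has to stay a partition along the way.
\<close>

lemma cutoff_product_dominance_mono:
  assumes P: "log_concave_fps P"
    and mono: "\<And>i l. 1 \<le> i \<Longrightarrow> i \<le> l \<Longrightarrow> l \<le> n \<Longrightarrow> \<mu> l \<le> \<mu> i"
    and "\<And>l. l \<le> n \<Longrightarrow> sum \<mu> {1..l} \<le> sum \<kappa> {1..l}"
    and "sum \<kappa> {1..n} = sum \<mu> {1..n}"
  shows "fps_nth (cutoff_product N P n \<kappa>) j \<le> fps_nth (cutoff_product N P n \<mu>) j"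
  using assms(3,4)
\<comment> \<open>Truncated subtraction makes the measure the total excess over
  \<open>\<mu>\<close>. A move lowers it by one, since row \<open>k\<close> stays at most
  \<open>\<mu> k\<close>.\<close>
proof (induction "\<Sum>i=1..n. \<kappa> i - \<mu> i" arbitrary: \<kappa> rule: less_induct)
  case less
  show ?case
  proof (cases "\<exists>k\<in>{1..n}. \<kappa> k < \<mu> k")
    case False
    then have "\<kappa> i = \<mu> i" if "i \<in> {1..n}" for i
      using sum_mono_inv[of \<mu> "{1..n}" \<kappa> i] less.prems(2) that by (metis finite_atLeastAtMost leI)
    then show ?thesis by (simp add: cutoff_product_def)
  next
    case True
    define k where "k = (LEAST k. k \<in> {1..n} \<and> \<kappa> k < \<mu> k)"
    have k: "k \<in> {1..n}" "\<kappa> k < \<mu> k"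
      using LeastI_ex[of "\<lambda>k. k \<in> {1..n} \<and> \<kappa> k < \<mu> k"] True unfolding k_def by blast+
    have before: "\<mu> l \<le> \<kappa> l" if "1 \<le> l" "l < k" for l
      using not_less_Least[of l "\<lambda>k. k \<in> {1..n} \<and> \<kappa> k < \<mu> k"] that k unfolding k_def
      by auto
    \<comment> \<open>Without such a row the prefix sum of \<open>\<kappa>\<close> up to
      \<open>k\<close> would fall below that of \<open>\<mu>\<close>.\<close>
    obtain i where i: "1 \<le> i" "i < k" "\<mu> i < \<kappa> i"
    proof (rule ccontr)
      assume "\<not> thesis"
      then have "sum \<kappa> {1..<k} \<le> sum \<mu> {1..<k}"
        using that by (intro sum_mono) (meson atLeastLessThan_iff leI)
      moreover have "{1..k} = insert k {1..<k}" using k by auto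
      ultimately show False using less.prems(1)[of k] k by auto
    qed
    let ?\<kappa> = "\<kappa>(i := \<kappa> i - 1, k := Suc (\<kappa> k))"
    \<comment> \<open>The chain is \<open>\<kappa> k < \<mu> k \<le> \<mu> i < \<kappa> i\<close>,
      with \<open>\<mu>\<close> nonincreasing in the middle.\<close>
    have ik: "\<kappa> k < \<kappa> i" using mono[of i k] i k by auto
    have prefix: "sum ?\<kappa> {1..l} + of_bool (i \<le> l) = sum \<kappa> {1..l} + of_bool (k \<le> l)" for l
    proof -
      have "sum ?\<kappa> {1..l} + (\<Sum>m\<in>{1..l}. of_bool (m = i))
          = sum \<kappa> {1..l} + (\<Sum>m\<in>{1..l}. of_bool (m = k))"
        unfolding sum.distrib[symmetric] by (intro sum.cong refl) (use i in auto)
      then show ?thesis using i k by (simp add: of_bool_def)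
    qed
    have "fps_nth (cutoff_product N P n \<kappa>) j \<le> fps_nth (cutoff_product N P n ?\<kappa>) j"
      using i k ik by (intro cutoff_product_transfer P) auto
    also have "\<dots> \<le> fps_nth (cutoff_product N P n \<mu>) j"
    proof (rule less.hyps)
      show "(\<Sum>l=1..n. ?\<kappa> l - \<mu> l) < (\<Sum>l=1..n. \<kappa> l - \<mu> l)"
        by (rule sum_strict_mono_ex1) (use i k in \<open>auto intro!: bexI[of _ i]\<close>)
      show "sum ?\<kappa> {1..n} = sum \<mu> {1..n}"
        using prefix[of n] less.prems(2) i k by auto
      fix l
      assume l: "l \<le> n"
      show "sum \<mu> {1..l} \<le> sum ?\<kappa> {1..l}"
      proof (cases "i \<le> l \<and> l < k")
        case True
        \<comment> \<open>Before \<open>k\<close> no row is below its target and row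
          \<open>i\<close> exceeds it, so this prefix can afford to lose one.\<close>
        then have "sum \<mu> {1..l} < sum \<kappa> {1..l}"
          by (intro sum_strict_mono_ex1) (use i before in \<open>auto intro!: bexI[of _ i]\<close>)
        then show ?thesis using prefix[of l] True by auto
      next
        case False
        then show ?thesis using prefix[of l] less.prems(1)[OF l] i by (auto split: if_splits)
      qed
    qed
    finally show ?thesis .
  qed
qed

section \<open>Constrained sums of independent variables\<close>

text \<open>
  The constraints \<open>B\<close> on the variables outside \<open>J\<close> let the induction fix the value of the next
  variable while still using only independence of events.
\<close>

lemma (in prob_space) prob_indep_sum_aux:
  fixes Y :: "'i \<Rightarrow> 'a \<Rightarrow> nat"
  assumes ind: "indep_vars (\<lambda>_. count_space UNIV) Y I" and I: "finite I" and "J \<subseteq> I"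
  shows "prob {\<omega> \<in> space M. (\<forall>i\<in>J. Y i \<omega> \<in> A i) \<and> (\<Sum>i\<in>J. Y i \<omega>) = j \<and> (\<forall>i\<in>I - J. Y i \<omega> \<in> B i)} =
    fps_nth (\<Prod>i\<in>J. Abs_fps (\<lambda>n. of_bool (n \<in> A i) * prob {\<omega> \<in> space M. Y i \<omega> = n})) j *
    (\<Prod>i\<in>I - J. prob {\<omega> \<in> space M. Y i \<omega> \<in> B i})"
proof -
  have rv [measurable]: "Y i \<in> measurable M (count_space UNIV)" if "i \<in> I" for i
    using ind that by (auto simp: indep_vars_def)
  have "finite J" using I \<open>J \<subseteq> I\<close> by (rule finite_subset[rotated])
  then show ?thesis
    using \<open>J \<subseteq> I\<close>
  proof (induction J arbitrary: j B)
    case empty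
    show ?case
    \<comment> \<open>\<open>indep_varsD_finite\<close> needs a nonempty \<open>I\<close>; in the
      other cases both sides are \<open>0\<close>, or both are \<open>1\<close>.\<close>
    proof (cases "j = 0 \<and> I \<noteq> {}")
      case True
      then have "prob (\<Inter>i\<in>I. Y i -` B i \<inter> space M) = (\<Prod>i\<in>I. prob (Y i -` B i \<inter> space M))"
        by (intro indep_varsD_finite[OF ind] I) auto
      moreover have "(\<Inter>i\<in>I. Y i -` B i \<inter> space M) = {\<omega> \<in> space M. \<forall>i\<in>I. Y i \<omega> \<in> B i}"
        using True by auto
      moreover have "Y i -` B i \<inter> space M = {\<omega> \<in> space M. Y i \<omega> \<in> B i}" for i
        by auto
      ultimately show ?thesis using True by simp
    qed (auto simp: prob_space)
  next
    case (insert i J)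
    \<comment> \<open>\<open>Y i\<close> is fixed at \<open>m\<close> by narrowing its constraint to
      \<open>{m} \<inter> A i\<close>; as \<open>i\<close> lies outside \<open>J\<close>, the
      induction hypothesis covers this event.\<close>
    let ?E = "\<lambda>m. {\<omega> \<in> space M. (\<forall>i\<in>J. Y i \<omega> \<in> A i) \<and> (\<Sum>i\<in>J. Y i \<omega>) = j - m \<and>
        (\<forall>l\<in>I - J. Y l \<omega> \<in> (B(i := {m} \<inter> A i)) l)}"
    let ?Q = "\<Prod>l\<in>I - insert i J. prob {\<omega> \<in> space M. Y l \<omega> \<in> B l}"
    have diff: "I - J = insert i (I - insert i J)" using insert.hyps insert.prems by auto
    have Q: "(\<Prod>l\<in>I - J. prob {\<omega> \<in> space M. Y l \<omega> \<in> (B(i := {m} \<inter> A i)) l}) =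
        of_bool (m \<in> A i) * prob {\<omega> \<in> space M. Y i \<omega> = m} * ?Q" for m
    proof -
      have "prob {\<omega> \<in> space M. Y i \<omega> \<in> {m} \<inter> A i} = of_bool (m \<in> A i) * prob {\<omega> \<in> space M. Y i \<omega> = m}"
        by (cases "m \<in> A i") (auto intro!: arg_cong[where f = prob])
      then show ?thesis
        unfolding diff using I by (auto intro!: prod.cong)
    qed
    have "{\<omega> \<in> space M. (\<forall>l\<in>insert i J. Y l \<omega> \<in> A l) \<and> (\<Sum>l\<in>insert i J. Y l \<omega>) = j \<and>
        (\<forall>l\<in>I - insert i J. Y l \<omega> \<in> B l)} = (\<Union>m\<in>{0..j}. ?E m)" (is "?L = ?R")
    proof (intro equalityI subsetI)
      fix \<omega> assume "\<omega> \<in> ?L"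
      then show "\<omega> \<in> ?R" using insert.hyps insert.prems diff by (auto intro!: exI[of _ "Y i \<omega>"])
    next
      fix \<omega> assume "\<omega> \<in> ?R"
      then obtain m where m: "m \<le> j" "\<omega> \<in> ?E m" by auto
      then have "Y i \<omega> = m" "Y i \<omega> \<in> A i" using diff by auto
      then show "\<omega> \<in> ?L" using m insert.hyps diff by (auto split: if_splits)
    qed
    also have "prob \<dots> = (\<Sum>m=0..j. prob (?E m))"
    proof (rule finite_measure_finite_Union)
      have [measurable]: "Y l \<in> measurable M (count_space UNIV)" if "l \<in> J" for l
        using rv insert.prems that by auto
      have [measurable]: "Y l \<in> measurable M (count_space UNIV)" if "l \<in> I - J" for l
        using rv that by auto
      have [simp]: "finite (I - J)" using I by simp
      have "?E m \<in> events" for m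
        using insert.hyps(1) by measurable
      then show "?E ` {0..j} \<subseteq> events" by blast
      show "disjoint_family_on ?E {0..j}"
        using diff by (auto simp: disjoint_family_on_def)
    qed simp
    also have "\<dots> = (\<Sum>m=0..j. of_bool (m \<in> A i) * prob {\<omega> \<in> space M. Y i \<omega> = m} *
        fps_nth (\<Prod>l\<in>J. Abs_fps (\<lambda>n. of_bool (n \<in> A l) * prob {\<omega> \<in> space M. Y l \<omega> = n})) (j - m)) * ?Q"
      using insert.prems unfolding sum_distrib_right
      by (intro sum.cong refl) (subst insert.IH, simp, simp only: Q, simp only: ac_simps)
    finally show ?case
      using insert.hyps by (simp add: fps_mult_nth)
  qed
qed

lemma (in prob_space) prob_indep_sum:
  fixes Y :: "'i \<Rightarrow> 'a \<Rightarrow> nat"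
  assumes "indep_vars (\<lambda>_. count_space UNIV) Y I" "finite I"
  shows "prob {\<omega> \<in> space M. (\<forall>i\<in>I. Y i \<omega> \<in> A i) \<and> (\<Sum>i\<in>I. Y i \<omega>) = j} =
    fps_nth (\<Prod>i\<in>I. Abs_fps (\<lambda>n. of_bool (n \<in> A i) * prob {\<omega> \<in> space M. Y i \<omega> = n})) j"
  using prob_indep_sum_aux[OF assms subset_refl, of A j] by simp

section \<open>Product spaces and independence of the copies\<close>

text \<open>The joint law of the coordinates is the product measure itself, whose factors are their
  marginal laws; this equality characterizes independence.\<close>

lemma indep_vars_PiM_components:
  assumes "\<And>i. i \<in> I \<Longrightarrow> prob_space (N i)" "I \<noteq> {}"
  shows "prob_space.indep_vars (PiM I N) N (\<lambda>i \<omega>. \<omega> i) I"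
proof -
  interpret prob_space "PiM I N" by (rule prob_space_PiM) (rule assms)
  have "distr (PiM I N) (PiM I N) (\<lambda>\<omega>. \<lambda>i\<in>I. \<omega> i) = PiM I N"
    by (subst distr_cong[where g = "\<lambda>\<omega>. \<omega>"])
      (auto simp: space_PiM PiE_def extensional_restrict distr_id2)
  also have "\<dots> = PiM I (\<lambda>i. distr (PiM I N) (N i) (\<lambda>\<omega>. \<omega> i))"
    by (intro PiM_cong refl distr_PiM_component[symmetric] assms) auto
  finally show ?thesis
    using assms by (subst indep_vars_iff_distr_eq_PiM') auto
qed

lemma copies_prob_space:
  assumes "prob_space M" "X \<in> measurable M (count_space UNIV)"
  shows "prob_space (copies M X)"
  unfolding copies_def by (intro prob_space_PiM prob_space.prob_space_distr assms)

lemma indep_vars_copies: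
  assumes "prob_space M" "X \<in> measurable M (count_space UNIV)"
  shows "prob_space.indep_vars (copies M X) (\<lambda>_. count_space UNIV) (\<lambda>x \<omega>. \<omega> x) UNIV"
proof -
  interpret prob_space "copies M X" by (rule copies_prob_space[OF assms])
  have "indep_vars (\<lambda>_. distr M (count_space UNIV) X) (\<lambda>x \<omega>. \<omega> x) UNIV"
    unfolding copies_def
    by (intro indep_vars_PiM_components prob_space.prob_space_distr assms) auto
  \<comment> \<open>Composing with the identity only replaces each target by
    \<open>count_space UNIV\<close>, which has the same measurable sets.\<close>
  from indep_vars_compose2[OF this, of "\<lambda>_ x. x" "\<lambda>_. count_space UNIV"]
  show ?thesis by simp
qed

lemma prob_copies_component:
  assumes "prob_space M" "X \<in> measurable M (count_space UNIV)"
  shows "Sigma_Algebra.measure (copies M X) {\<omega> \<in> space (copies M X). \<omega> x = n} =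
    Sigma_Algebra.measure M {\<omega> \<in> space M. X \<omega> = n}"
proof -
  let ?D = "distr M (count_space UNIV) X"
  have meas: "(\<lambda>\<omega>. \<omega> x) \<in> measurable (copies M X) ?D"
    unfolding copies_def by (rule measurable_component_singleton) simp
  have "distr (copies M X) ?D (\<lambda>\<omega>. \<omega> x) = ?D"
    unfolding copies_def
    by (rule distr_PiM_component) (auto intro!: prob_space.prob_space_distr assms)
  then have "Sigma_Algebra.measure ?D {n} = Sigma_Algebra.measure (distr (copies M X) ?D (\<lambda>\<omega>. \<omega> x)) {n}"
    by simp
  also have "\<dots> = Sigma_Algebra.measure (copies M X) ((\<lambda>\<omega>. \<omega> x) -` {n} \<inter> space (copies M X))"
    using meas by (rule measure_distr) simp
  finally show ?thesis
    using assms(2) by (simp add: measure_distr vimage_def Int_def conj_commute)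
qed

section \<open>Row sums and the probability of \<open>event_E\<close>\<close>

definition pgf :: "'a measure \<Rightarrow> ('a \<Rightarrow> nat) \<Rightarrow> real fps" where
  "pgf M X = Abs_fps (\<lambda>n. Sigma_Algebra.measure M {\<omega> \<in> space M. X \<omega> = n})"

lemma pgf_row_sum:
  assumes "prob_space M" "X \<in> measurable M (count_space UNIV)"
  shows "pgf (copies M X) (row_sum \<nu> i) = pgf M X ^ \<nu> i"
proof (rule fps_ext)
  fix n
  interpret prob_space "copies M X" by (rule copies_prob_space[OF assms])
  let ?J = "{i} \<times> {..<\<nu> i}"
  have "indep_vars (\<lambda>_. count_space UNIV) (\<lambda>x \<omega>. \<omega> x) ?J"
    using indep_vars_copies[OF assms] by (rule indep_vars_subset) simp
  from prob_indep_sum[OF this, of "\<lambda>_. UNIV" n]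
  have "prob {\<omega> \<in> space (copies M X). (\<Sum>x\<in>?J. \<omega> x) = n} = fps_nth (pgf M X ^ \<nu> i) n"
    by (simp add: prob_copies_component[OF assms] pgf_def card_cartesian_product)
  moreover have "row_sum \<nu> i \<omega> = (\<Sum>x\<in>?J. \<omega> x)" for \<omega>
    unfolding row_sum_def by (rule sum.reindex_bij_witness[of _ snd "Pair i"]) auto
  ultimately show "fps_nth (pgf (copies M X) (row_sum \<nu> i)) n = fps_nth (pgf M X ^ \<nu> i) n"
    by (simp add: pgf_def)
qed

text \<open>Each row sum reads only its own block \<open>{i} \<times> UNIV\<close> of coordinates,
  and these blocks are disjoint.\<close>

lemma indep_vars_row_sum:
  assumes "prob_space M" "X \<in> measurable M (count_space UNIV)"
  shows "prob_space.indep_vars (copies M X) (\<lambda>_. count_space UNIV) (row_sum \<nu>) UNIV"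
proof -
  interpret prob_space "copies M X" by (rule copies_prob_space[OF assms])
  let ?K = "\<lambda>i. {i} \<times> (UNIV :: nat set)"
  have "indep_vars (\<lambda>i. PiM (?K i) (\<lambda>_. count_space UNIV)) (\<lambda>i \<omega>. \<lambda>x\<in>?K i. \<omega> x) UNIV"
    by (rule indep_vars_restrict[OF indep_vars_copies[OF assms]])
      (auto simp: disjoint_family_on_def)
  moreover have "row_sum \<nu> i \<in> measurable (PiM (?K i) (\<lambda>_. count_space UNIV)) (count_space UNIV)" for i
    unfolding row_sum_def by measurable
  ultimately have "indep_vars (\<lambda>_. count_space UNIV) (\<lambda>i \<omega>. row_sum \<nu> i (\<lambda>x\<in>?K i. \<omega> x)) UNIV"
    by (rule indep_vars_compose2)
  then show ?thesis by (simp add: row_sum_def[abs_def])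
qed

text \<open>\<open>fps_cutoff N\<close> keeps degrees below \<open>N\<close>, hence
  \<open>Suc t\<close>. Rows with \<open>\<nu> i = 0\<close> are identically zero, so any bound
  \<open>n\<close> on the support serves, and two partitions can share one.\<close>

lemma measure_event_E:
  assumes "prob_space M" "X \<in> measurable M (count_space UNIV)"
    and supp: "{i. 1 \<le> i \<and> \<nu> i \<noteq> 0} \<subseteq> {1..n}"
  shows "Sigma_Algebra.measure (copies M X) (event_E \<nu> M X j t) =
    fps_nth (cutoff_product (Suc t) (pgf M X) n \<nu>) j"
proof -
  interpret prob_space "copies M X" by (rule copies_prob_space[OF assms(1,2)])
  have "indep_vars (\<lambda>_. count_space UNIV) (row_sum \<nu>) {1..n}"
    using indep_vars_row_sum[OF assms(1,2)] by (rule indep_vars_subset) simp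
  from prob_indep_sum[OF this, of "\<lambda>_. {..t}" j]
  have "prob {\<omega> \<in> space (copies M X). (\<forall>i\<in>{1..n}. row_sum \<nu> i \<omega> \<le> t) \<and> (\<Sum>i=1..n. row_sum \<nu> i \<omega>) = j} =
      fps_nth (\<Prod>i=1..n. Abs_fps (\<lambda>m. of_bool (m \<le> t) *
        prob {\<omega> \<in> space (copies M X). row_sum \<nu> i \<omega> = m})) j"
    by simp
  moreover have "Abs_fps (\<lambda>m. of_bool (m \<le> t) * prob {\<omega> \<in> space (copies M X). row_sum \<nu> i \<omega> = m}) =
      fps_cutoff (Suc t) (pgf M X ^ \<nu> i)" for i
    unfolding pgf_row_sum[OF assms(1,2), symmetric] by (rule fps_ext) (auto simp: pgf_def)
  moreover have "{\<omega> \<in> space (copies M X). (\<forall>i\<in>{1..n}. row_sum \<nu> i \<omega> \<le> t) \<and> (\<Sum>i=1..n. row_sum \<nu> i \<omega>) = j} =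
      event_E \<nu> M X j t"
  proof -
    have zero: "row_sum \<nu> i \<omega> = 0" if "\<nu> i = 0" for i \<omega>
      using that by (simp add: row_sum_def)
    have "(\<Sum>i | 1 \<le> i \<and> \<nu> i \<noteq> 0. row_sum \<nu> i \<omega>) = (\<Sum>i=1..n. row_sum \<nu> i \<omega>)" for \<omega>
      by (rule sum.mono_neutral_left) (use supp zero in auto)
    moreover have "(\<forall>i\<in>{1..n}. row_sum \<nu> i \<omega> \<le> t) \<longleftrightarrow> (\<forall>i\<ge>1. row_sum \<nu> i \<omega> \<le> t)" for \<omega>
      using supp zero by (metis (mono_tags, lifting) atLeastAtMost_iff mem_Collect_eq subsetD zero_le)
    ultimately show ?thesis by (simp add: event_E_def)
  qed
  ultimately show ?thesis by (simp add: cutoff_product_def)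
qed

section \<open>Minors of order two and the conclusion\<close>

lemma det_mat_2:
  fixes f :: "nat \<times> nat \<Rightarrow> 'a :: comm_ring_1"
  shows "Determinant.det (Matrix.mat 2 2 f) = f (0, 0) * f (1, 1) - f (0, 1) * f (1, 0)"
proof -
  let ?A = "Matrix.mat 2 2 f"
  have "Determinant.det (mat_delete ?A 0 j) = f (1, 1 - j)" if "j < 2" for j
    using that by (subst det_single) (auto simp: mat_delete_def)
  moreover have "Determinant.det ?A = (\<Sum>j<2. ?A $$ (0, j) * cofactor ?A 0 j)"
    by (rule laplace_expansion_row) auto
  ultimately show ?thesis
    by (simp add: cofactor_def numeral_2_eq_2)
qed

lemma TN_var_log_concave:
  assumes "TN_var 2 M X"
  shows "log_concave_fps (pgf M X)"
proof -
  let ?T = "toeplitz (fps_nth (pgf M X))"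
  have "?T i j' * ?T i' j \<le> ?T i j * ?T i' j'" if "i < i'" "j < j'" for i i' j j'
  proof -
    have "strict_mono_on {..<2} (\<lambda>a::nat. if a = 0 then i else i')"
      "strict_mono_on {..<2} (\<lambda>a::nat. if a = 0 then j else j')"
      using that by (auto simp: strict_mono_on_def)
    with assms[unfolded TN_var_def totally_nonneg_def, rule_format, of 2
        "\<lambda>a. if a = 0 then i else i'" "\<lambda>a. if a = 0 then j else j'"]
    show ?thesis
      by (simp add: det_mat_2 pgf_def Abs_fps_inverse)
  qed
  \<comment> \<open>Minors cover strictly ordered indices; if two rows or two columns coincide, both
    sides are equal.\<close>
  then have "TP2 ?T"
    unfolding TP2_def by (metis le_less mult.commute order_refl)
  then show ?thesis by (simp add: log_concave_fps_def pgf_def)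
qed

theorem theorem5:
  fixes M :: "'a measure" and X :: "'a \<Rightarrow> nat"
  assumes "prob_space M"
    and "X \<in> measurable M (count_space UNIV)"
    and "TN_var 2 M X"
  shows "\<forall>\<kappa> \<mu>. is_partition \<kappa> \<and> is_partition \<mu> \<longrightarrow> \<kappa> \<unrhd> \<mu> \<longrightarrow> cond_C \<kappa> \<mu> M X"
proof (intro allI impI)
  fix \<kappa> \<mu> :: "nat \<Rightarrow> nat"
  assume part: "is_partition \<kappa> \<and> is_partition \<mu>" and dom: "\<kappa> \<unrhd> \<mu>"
  let ?S = "\<lambda>\<nu>. {i. 1 \<le> i \<and> \<nu> i \<noteq> (0::nat)}"
  obtain n where "?S \<kappa> \<union> ?S \<mu> \<subseteq> {..n}"
    using part unfolding is_partition_def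
    by (metis (no_types, lifting) finite_Un finite_nat_iff_bounded_le)
  then have supp: "?S \<kappa> \<subseteq> {1..n}" "?S \<mu> \<subseteq> {1..n}" by auto
  have weight: "sum \<nu> {1..n} = weight \<nu>" if "?S \<nu> \<subseteq> {1..n}" for \<nu>
    unfolding weight_def by (rule sum.mono_neutral_right) (use that in auto)
  have "sum \<mu> {1..l} \<le> sum \<kappa> {1..l}" for l
    using dom by (cases "l \<ge> 1") (auto simp: dominates_def)
  moreover have "sum \<kappa> {1..n} = sum \<mu> {1..n}"
    using dom weight supp by (simp add: dominates_def)
  ultimately have "fps_nth (cutoff_product N (pgf M X) n \<kappa>) j \<le> fps_nth (cutoff_product N (pgf M X) n \<mu>) j"
    for N j
    using part TN_var_log_concave[OF assms(3)]
    by (intro cutoff_product_dominance_mono) (auto simp: is_partition_def)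
  then show "cond_C \<kappa> \<mu> M X"
    unfolding cond_C_def measure_event_E[OF assms(1,2) supp(1)] measure_event_E[OF assms(1,2) supp(2)]
    by blast
qed

end
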